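(* Let $F$ be a finite-dimensional real inner product space of dimension at least $1$, with norm $\|\cdot\|_F$, and let $T>0$. For every $N\in\mathbb N$, $$A_N=\frac{1}{2N},$$ where $A_N$ is the minimax input error defined in the context. Moreover, the value is attained by the sampled equal-variation encoder $f_N^\star$ (defined in the context), i.e. $A(f_N^\star)=\frac1{2N}$. In particular, $$\|\pi-f_N^\star(\pi)\|_{L^\infty([0,T];F)}\le \frac{1}{2N}\,\|\pi\|_{BV,0}\qquad\text{for all }\pi\in W^{1,1}([0,T];F).$$
   Context: Setting: in the paper $F=(\mathbb R^n)^*$ is a stress space with inner product $\langle\sigma^1,\sigma^2\rangle_F=\mathbb C^{-1}\sigma^1\cdot\sigma^2$, where $\mathbb C$ is a symmetric positive-definite map $\mathbb R^n\to F$; only the inner product structure matters. Variation: for $u:[0,T]\to F$ and $[a,b]\subset[0,T]$, $\operatorname{Var}(u;[a,b])=\sup\sum_j\|u(t_j)-u(t_{j-1})\|_F$ over all partitions $a=t_0<\dots<t_m=b$. Elements of $W^{1,1}([0,T];F)$ are identified with their absolutely continuous representatives. $\|u\|_{BV,0}:=\|u(0)\|_F+\operatorname{Var}(u;[0,T])$. Step functions: $\mathcal Z_N$ is the set of functions $z:[0,T]\to F$ for which there exist $M\le N$, a partition $0=t_0<\dots<t_M=T$ and values $z_0,\dots,z_M\in F$ with $z(t)=z_{k-1}$ for $t\in[t_{k-1},t_k)$, $k=1,\dots,M$, and $z(T)=z_M$. Encoders and errors: an encoder is an arbitrary map $f_N:W^{1,1}([0,T];F)\to\mathcal Z_N$.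 Its input error is $$A(f_N):=\sup_{\pi\in W^{1,1}([0,T];F)\setminus\{0\}}\frac{\|\pi-f_N(\pi)\|_{L^\infty([0,T];F)}}{\|\pi\|_{BV,0}},\qquad A_N:=\inf_{f_N}A(f_N),$$ the infimum being over all encoders. Sampled equal-variation encoder $f_N^\star$: let $V:=\operatorname{Var}(\pi;[0,T])$ and $\alpha(t):=\operatorname{Var}(\pi;[0,t])$ (continuous). If $V=0$, $f_N^\star(\pi)\equiv\pi(0)$. If $V>0$, let $t_k:=\min\{t\in[0,T]:\alpha(t)=kV/N\}$ for $k=0,\dots,N-1$, $t_N:=T$, and for $k=1,\dots,N$ choose $\tau_k\in[t_{k-1},t_k]$ with $\alpha(\tau_k)=\frac{(2k-1)V}{2N}$ (any such choice). Then $f_N^\star(\pi)(t):=\pi(\tau_k)$ for $t\in[t_{k-1},t_k)$, $k=1,\dots,N$, and $f_N^\star(\pi)(T):=\pi(T)$. *)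

theory Defs
  imports "HOL-Probability.Essential_Supremum"
begin

text \<open>
  A function on \<open>[0,T]\<close> is an element of \<open>extensional {0..T}\<close>, so that equality of
  such functions is equality on \<open>[0,T]\<close>.  Suprema and infima are taken in \<open>[0,\<infinity>]\<close>
  (type \<^typ>\<open>ennreal\<close>), where the supremum of the empty set is 0.
\<close>

text \<open>For \<open>a = b\<close> the only admissible partition has \<open>m = 0\<close>.\<close>

definition variation :: "(real \<Rightarrow> 'a::real_normed_vector) \<Rightarrow> real \<Rightarrow> real \<Rightarrow> ennreal" where
  "variation u a b =
    (SUP (m, t) \<in> {(m::nat, t::nat \<Rightarrow> real). t 0 = a \<and> t m = b \<and> (\<forall>j<m. t j < t (Suc j))}.
       \<Sum>j=1..m. ennreal (norm (u (t j) - u (t (j - 1)))))"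

definition BV0_norm :: "real \<Rightarrow> (real \<Rightarrow> 'a::real_normed_vector) \<Rightarrow> ennreal" where
  "BV0_norm T u = ennreal (norm (u 0)) + variation u 0 T"

definition Linf_norm :: "real \<Rightarrow> (real \<Rightarrow> 'a::real_normed_vector) \<Rightarrow> ennreal" where
  "Linf_norm T u = esssup (lebesgue_on {0..T}) (\<lambda>t. ennreal (norm (u t)))"

definition absolutely_continuous_on :: "real \<Rightarrow> real \<Rightarrow> (real \<Rightarrow> 'a::real_normed_vector) \<Rightarrow> bool" where
  "absolutely_continuous_on a b u \<longleftrightarrow>
    (\<forall>\<epsilon>>0. \<exists>\<delta>>0. \<forall>(m::nat) l r.
       (\<forall>i<m. a \<le> l i \<and> l i \<le> r i \<and> r i \<le> b) \<and>
       disjoint_family_on (\<lambda>i. {l i<..<r i}) {..<m} \<and>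
       (\<Sum>i<m. r i - l i) < \<delta> \<longrightarrow>
       (\<Sum>i<m. norm (u (r i) - u (l i))) < \<epsilon>)"

definition test_function :: "real \<Rightarrow> (real \<Rightarrow> real) \<Rightarrow> bool" where
  "test_function T \<phi> \<longleftrightarrow>
    (\<forall>k x. (deriv ^^ k) \<phi> field_differentiable (at x)) \<and>
    compact (closure {x. \<phi> x \<noteq> 0}) \<and> closure {x. \<phi> x \<noteq> 0} \<subseteq> {0<..<T}"

definition weak_derivative :: "real \<Rightarrow> (real \<Rightarrow> 'a::euclidean_space) \<Rightarrow> (real \<Rightarrow> 'a) \<Rightarrow> bool" where
  "weak_derivative T u g \<longleftrightarrow>
    (\<forall>\<phi>. test_function T \<phi> \<longrightarrow>
       integral {0..T} (\<lambda>t. deriv \<phi> t *\<^sub>R u t) = - integral {0..T} (\<lambda>t. \<phi> t *\<^sub>R g t))"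

text \<open>
  The elements of \<open>W\<^sup>1\<^sup>,\<^sup>1([0,T])\<close>, identified with their absolutely continuous
  representatives: each Sobolev class contains exactly one function of the set below.
\<close>

definition W11 :: "real \<Rightarrow> (real \<Rightarrow> 'a::euclidean_space) set" where
  "W11 T = {u \<in> extensional {0..T}.
     absolutely_continuous_on 0 T u \<and>
     u absolutely_integrable_on {0..T} \<and>
     (\<exists>g. g absolutely_integrable_on {0..T} \<and> weak_derivative T u g)}"

definition step_functions :: "real \<Rightarrow> nat \<Rightarrow> (real \<Rightarrow> 'a) set" where
  "step_functions T N = {z \<in> extensional {0..T}.
     \<exists>M\<le>N. \<exists>(t::nat \<Rightarrow> real) (v::nat \<Rightarrow> 'a).
       t 0 = 0 \<and> t M = T \<and> (\<forall>k<M. t k < t (Suc k)) \<and>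
       (\<forall>k\<in>{1..M}. \<forall>s\<in>{t (k - 1)..<t k}. z s = v (k - 1)) \<and> z T = v M}"

definition encoders :: "real \<Rightarrow> nat \<Rightarrow> ((real \<Rightarrow> 'a::euclidean_space) \<Rightarrow> (real \<Rightarrow> 'a)) set" where
  "encoders T N = W11 T \<rightarrow> step_functions T N"

definition input_error :: "real \<Rightarrow> ((real \<Rightarrow> 'a::euclidean_space) \<Rightarrow> (real \<Rightarrow> 'a)) \<Rightarrow> ennreal" where
  "input_error T f =
    (SUP \<pi> \<in> W11 T - {\<lambda>t\<in>{0..T}. 0}. Linf_norm T (\<lambda>t. \<pi> t - f \<pi> t) / BV0_norm T \<pi>)"

text \<open>The \<open>itself\<close> argument carries the space \<open>F\<close>.\<close>

definition minimax_input_error :: "'a::euclidean_space itself \<Rightarrow> real \<Rightarrow> nat \<Rightarrow> ennreal" where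
  "minimax_input_error _ T N =
    (INF f \<in> (encoders T N :: ((real \<Rightarrow> 'a) \<Rightarrow> (real \<Rightarrow> 'a)) set). input_error T f)"

definition equal_variation_time :: "real \<Rightarrow> nat \<Rightarrow> (real \<Rightarrow> 'a::real_normed_vector) \<Rightarrow> nat \<Rightarrow> real" where
  "equal_variation_time T N \<pi> k =
    (if k = N then T
     else LEAST t. t \<in> {0..T} \<and> variation \<pi> 0 t = of_nat k * variation \<pi> 0 T / of_nat N)"

text \<open>
  The sampling points \<open>\<tau>\<close> are not unique, so the encoder is given as a predicate:
  it holds of \<open>f\<close> iff \<open>f\<close> arises from some admissible choice of the \<open>\<tau>\<close>'s for each input.
\<close>

definition sampled_equal_variation_output ::
    "real \<Rightarrow> nat \<Rightarrow> (real \<Rightarrow> 'a::real_normed_vector) \<Rightarrow> (real \<Rightarrow> 'a) \<Rightarrow> bool" where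
  "sampled_equal_variation_output T N \<pi> z \<longleftrightarrow>
    (if variation \<pi> 0 T = 0 then z = (\<lambda>t\<in>{0..T}. \<pi> 0)
     else z \<in> extensional {0..T} \<and> z T = \<pi> T \<and>
       (\<exists>\<tau>::nat \<Rightarrow> real. \<forall>k\<in>{1..N}.
          \<tau> k \<in> {equal_variation_time T N \<pi> (k - 1)..equal_variation_time T N \<pi> k} \<and>
          variation \<pi> 0 (\<tau> k) = of_nat (2 * k - 1) * variation \<pi> 0 T / of_nat (2 * N) \<and>
          (\<forall>t\<in>{equal_variation_time T N \<pi> (k - 1)..<equal_variation_time T N \<pi> k}.
             z t = \<pi> (\<tau> k))))"

definition sampled_equal_variation_encoder ::
    "real \<Rightarrow> nat \<Rightarrow> ((real \<Rightarrow> 'a::euclidean_space) \<Rightarrow> (real \<Rightarrow> 'a)) \<Rightarrow> bool" where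
  "sampled_equal_variation_encoder T N f \<longleftrightarrow>
    (\<forall>\<pi>\<in>W11 T. sampled_equal_variation_output T N \<pi> (f \<pi>))"

end

theory Submission
  imports Defs
begin

text \<open>
  Writing \<open>\<alpha> t\<close> for the variation of \<open>\<pi>\<close> on \<open>[0,t]\<close>, one has
  \<open>\<parallel>\<pi> t - \<pi> s\<parallel> \<le> \<bar>\<alpha> t - \<alpha> s\<bar>\<close>, and \<open>\<alpha>\<close> is continuous when \<open>\<pi>\<close> is absolutely continuous.
  On the \<open>k\<close>-th piece \<open>\<alpha>\<close> ranges over an interval of length \<open>V / N\<close> and is sampled at its
  midpoint, so the error is at most \<open>V / (2 N)\<close>.  Conversely, the ramp \<open>t \<mapsto> (t / T) e\<close> with
  \<open>\<parallel>e\<parallel> = 1\<close> has BV norm 1, and one of the at most \<open>N\<close> pieces of any step function has length at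
  least \<open>T / N\<close>; the ramp changes by \<open>1 / N\<close> there, so a constant misses it by at least
  \<open>1 / (2 N)\<close>.
\<close>

subsection \<open>Variation of absolutely continuous functions\<close>

lemma chain_mono:
  fixes t :: "nat \<Rightarrow> 'a::order"
  assumes "\<forall>j<m. t j < t (Suc j)" "i \<le> j" "j \<le> m"
  shows "t i \<le> t j"
  using assms(2,3)
proof (induction j rule: dec_induct)
  case (step n)
  then show ?case
    using assms(1) by (meson Suc_le_eq less_imp_le order.trans)
qed simp

text \<open>Locates the partition piece containing \<open>s\<close>: for the least \<open>k\<close>
  with \<open>s < t k\<close>, minimality forces \<open>t (k - 1) \<le> s\<close>.\<close>

lemma chain_interval:
  fixes t :: "nat \<Rightarrow> 'a::linorder"
  assumes "\<forall>j<m. t j < t (Suc j)" "t 0 \<le> s" "s < t m"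
  obtains k where "k \<in> {1..m}" "t (k - 1) \<le> s" "s < t k"
proof -
  define k where "k = (LEAST k. s < t k)"
  have k: "s < t k" "k \<le> m"
    unfolding k_def using assms(3) by (auto intro: LeastI Least_le)
  have "k \<noteq> 0"
    using k(1) assms(2) by (metis leD)
  then have "\<not> s < t (k - 1)"
    unfolding k_def by (metis (mono_tags) diff_less not_less_Least zero_less_one gr0I)
  with k \<open>k \<noteq> 0\<close> show thesis
    by (intro that[of k]) auto
qed

text \<open>With \<open>variation_le\<close>, the two halves of the supremum, reindexed from
  \<open>{1..m}\<close> to \<open>{..<m}\<close> to suit induction on \<open>m\<close> and
  telescoping.\<close>

lemma variation_ge:
  assumes "t 0 = a" "t m = b" "\<forall>j<m. t j < t (Suc j)"
  shows "(\<Sum>j<m. ennreal (norm (u (t (Suc j)) - u (t j)))) \<le> variation u a b"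
  unfolding variation_def using assms
  by (intro SUP_upper2[where i = "(m, t)"]) (auto simp: sum.atLeast1_atMost_eq)

lemma variation_le:
  assumes "\<And>m t. t 0 = a \<Longrightarrow> t m = b \<Longrightarrow> \<forall>j<m. t j < t (Suc j) \<Longrightarrow>
    (\<Sum>j<m. ennreal (norm (u (t (Suc j)) - u (t j)))) \<le> C"
  shows "variation u a b \<le> C"
  unfolding variation_def using assms
  by (intro SUP_least) (auto simp: sum.atLeast1_atMost_eq)

lemma variation_self: "variation u a a = 0"
proof -
  have "variation u a a \<le> 0"
  proof (rule variation_le)
    fix m and t :: "nat \<Rightarrow> real"
    assume t: "t 0 = a" "t m = a" "\<forall>j<m. t j < t (Suc j)"
    have "m = 0"
      using chain_mono[OF t(3), of 1 m] t by (cases m) force+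
    then show "(\<Sum>j<m. ennreal (norm (u (t (Suc j)) - u (t j)))) \<le> 0"
      by simp
  qed
  then show ?thesis by simp
qed

text \<open>Appending \<open>c\<close> to a partition of \<open>[a,b]\<close> gives one of
  \<open>[a,c]\<close>. The case \<open>b = c\<close> is separate because partitions increase
  strictly.\<close>

lemma variation_append:
  assumes "a \<le> b" "b \<le> c"
  shows "variation u a b + ennreal (norm (u c - u b)) \<le> variation u a c"
proof (cases "b = c")
  case False
  let ?P = "{(m::nat, t::nat \<Rightarrow> real). t 0 = a \<and> t m = b \<and> (\<forall>j<m. t j < t (Suc j))}"
  \<comment> \<open>A constant can move inside the supremum only over a nonempty index set: the
    empty supremum is 0 and would lose it.\<close>
  have ne: "?P \<noteq> {}"
  proof (cases "a = b")
    case True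
    then have "(0, \<lambda>_. a) \<in> ?P" by auto
    then show ?thesis by blast
  next
    case False
    then have "(1, \<lambda>j. if j = 0 then a else b) \<in> ?P"
      using assms by auto
    then show ?thesis by blast
  qed
  have "variation u a b + ennreal (norm (u c - u b)) =
    (SUP p\<in>?P. (case p of (m, t) \<Rightarrow> \<Sum>j=1..m. ennreal (norm (u (t j) - u (t (j - 1)))))
       + ennreal (norm (u c - u b)))"
    unfolding variation_def by (rule ennreal_SUP_add_left[OF ne, symmetric])
  also have "\<dots> \<le> variation u a c"
  proof (rule SUP_least, clarify)
    fix m and t :: "nat \<Rightarrow> real"
    assume t: "b = t m" "\<forall>j<m. t j < t (Suc j)" "a = t 0"
    define s where "s = t(Suc m := c)"
    have "(\<Sum>j<Suc m. ennreal (norm (u (s (Suc j)) - u (s j)))) \<le> variation u (t 0) c"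
      using t assms False by (intro variation_ge) (auto simp: s_def less_Suc_eq)
    moreover have "(\<Sum>j<m. ennreal (norm (u (s (Suc j)) - u (s j)))) =
        (\<Sum>j<m. ennreal (norm (u (t (Suc j)) - u (t j))))"
      by (intro sum.cong) (auto simp: s_def)
    ultimately show "(\<Sum>j=1..m. ennreal (norm (u (t j) - u (t (j - 1)))))
        + ennreal (norm (u c - u (t m))) \<le> variation u (t 0) c"
      by (simp add: s_def sum.atLeast1_atMost_eq)
  qed
  finally show ?thesis .
qed simp

lemma variation_mono:
  assumes "a \<le> b" "b \<le> c"
  shows "variation u a b \<le> variation u a c"
  using variation_append[OF assms, of u] by (metis dual_order.trans le_iff_add)

lemma norm_diff_le_variation:
  assumes "a \<le> b"
  shows "ennreal (norm (u b - u a)) \<le> variation u a b"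
  using variation_append[of a a b u] assms by (simp add: variation_self)

text \<open>Induction on the number of partition points with \<open>c\<close> generalised, so that
  removing the last point leaves a partition ending at \<open>t m\<close>, to which the hypothesis
  applies if \<open>b \<le> t m\<close>.\<close>

lemma variation_subadditive:
  assumes "a \<le> b" "b \<le> c"
  shows "variation u a c \<le> variation u a b + variation u b c"
proof (rule variation_le)
  fix m and t :: "nat \<Rightarrow> real"
  assume "t 0 = a" "t m = c" "\<forall>j<m. t j < t (Suc j)"
  then show "(\<Sum>j<m. ennreal (norm (u (t (Suc j)) - u (t j))))
      \<le> variation u a b + variation u b c"
    using assms(2)
  proof (induction m arbitrary: c)
    case (Suc m)
    let ?S = "\<Sum>j<m. ennreal (norm (u (t (Suc j)) - u (t j)))"
    let ?d = "ennreal (norm (u c - u (t m)))"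
    have d: "t m < c" and dec: "\<forall>j<m. t j < t (Suc j)"
      using Suc.prems by auto
    have a: "a \<le> t m"
      using chain_mono[OF dec, of 0 m] Suc.prems by simp
    have "?S + ?d \<le> variation u a b + variation u b c"
    proof (cases "b \<le> t m")
      case True
      have "?S \<le> variation u a b + variation u b (t m)"
        by (rule Suc.IH) (use Suc.prems dec True in auto)
      then have "?S + ?d \<le> variation u a b + (variation u b (t m) + ?d)"
        using add_right_mono[of ?S _ ?d] by (simp add: add.assoc)
      also have "\<dots> \<le> variation u a b + variation u b c"
        using variation_append[OF True, of c u] d by (intro add_left_mono) simp
      finally show ?thesis .
    \<comment> \<open>The last increment straddles \<open>b\<close>: the triangle inequality splits
      it there, the first half extending the partition of \<open>[a, t m]\<close> to
      \<open>b\<close>, the second being bounded by the variation on \<open>[b,c]\<close>.\<close>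
    next
      case False
      have "?S \<le> variation u a (t m)"
        using Suc.prems dec by (intro variation_ge) auto
      moreover have "?d \<le> ennreal (norm (u b - u (t m))) + ennreal (norm (u c - u b))"
        using ennreal_leI[OF norm_triangle_ineq[of "u b - u (t m)" "u c - u b"]]
        by (simp add: ennreal_plus)
      ultimately have "?S + ?d \<le> variation u a (t m) + ennreal (norm (u b - u (t m)))
          + ennreal (norm (u c - u b))"
        using add_mono[of ?S] by (simp add: add.assoc)
      also have "\<dots> \<le> variation u a b + variation u b c"
        using variation_append[OF a, of b u] norm_diff_le_variation[OF Suc.prems(4), of u] False
        by (intro add_mono) auto
      finally show ?thesis .
    qed
    then show ?case
      using Suc.prems(2) by simp
  qed simp
qed

text \<open>The consecutive intervals of any partition of \<open>[s,r]\<close> are disjoint with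
  total length \<open>r - s\<close>, so a single \<delta> serves all partitions and the bound passes
  to the supremum.\<close>

lemma absolutely_continuous_on_variation_small:
  assumes "absolutely_continuous_on a b u" "\<epsilon> > 0"
  obtains \<delta> where "\<delta> > 0"
    "\<And>s r. a \<le> s \<Longrightarrow> s \<le> r \<Longrightarrow> r \<le> b \<Longrightarrow> r - s < \<delta> \<Longrightarrow> variation u s r \<le> ennreal \<epsilon>"
proof -
  obtain \<delta> where "\<delta> > 0" and \<delta>:
    "\<forall>(m::nat) l r. (\<forall>i<m. a \<le> l i \<and> l i \<le> r i \<and> r i \<le> b) \<and>
       disjoint_family_on (\<lambda>i. {l i<..<r i}) {..<m} \<and> (\<Sum>i<m. r i - l i) < \<delta> \<longrightarrow>
       (\<Sum>i<m. norm (u (r i) - u (l i))) < \<epsilon>"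
    by (rule exE[OF assms(1)[unfolded absolutely_continuous_on_def, THEN spec, THEN mp, OF assms(2)]])
      (elim conjE, rule that)
  show thesis
  proof (rule that[OF \<open>\<delta> > 0\<close>])
    fix s r
    assume sr: "a \<le> s" "s \<le> r" "r \<le> b" "r - s < \<delta>"
    show "variation u s r \<le> ennreal \<epsilon>"
    proof (rule variation_le)
      fix m and t :: "nat \<Rightarrow> real"
      assume t: "t 0 = s" "t m = r" "\<forall>j<m. t j < t (Suc j)"
      note mono = chain_mono[OF t(3)]
      have "disjoint_family_on (\<lambda>i. {t i<..<t (Suc i)}) {..<m}"
      proof (unfold disjoint_family_on_def, intro ballI impI)
        fix i j :: nat
        assume "i \<in> {..<m}" "j \<in> {..<m}" "i \<noteq> j"
        then have "t (Suc i) \<le> t j \<or> t (Suc j) \<le> t i"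
          using mono[of "Suc i" j] mono[of "Suc j" i] by (cases i j rule: linorder_cases) auto
        then show "{t i<..<t (Suc i)} \<inter> {t j<..<t (Suc j)} = {}"
          by auto
      qed
      moreover have "a \<le> t i \<and> t i \<le> t (Suc i) \<and> t (Suc i) \<le> b" if "i < m" for i
        using mono[of 0 i] mono[of i "Suc i"] mono[of "Suc i" m] t sr that by auto
      moreover have "(\<Sum>i<m. t (Suc i) - t i) < \<delta>"
        using sr t by (simp add: sum_lessThan_telescope)
      ultimately have "(\<Sum>i<m. norm (u (t (Suc i)) - u (t i))) < \<epsilon>"
        using \<delta>[THEN spec, THEN spec, THEN spec, of m t "\<lambda>i. t (Suc i)"] by simp
      then show "(\<Sum>j<m. ennreal (norm (u (t (Suc j)) - u (t j)))) \<le> ennreal \<epsilon>"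
        by (simp add: ennreal_leI)
    qed
  qed
qed

text \<open>Walk from \<open>a\<close> to \<open>b\<close> in steps of \<delta>/2, each adding at
  most 1 to the variation; finitely many steps suffice.\<close>

lemma absolutely_continuous_on_variation_finite:
  assumes "absolutely_continuous_on a b u" "a \<le> b"
  shows "variation u a b < top"
proof -
  obtain \<delta> where "\<delta> > 0" and \<delta>:
    "\<And>s r. a \<le> s \<Longrightarrow> s \<le> r \<Longrightarrow> r \<le> b \<Longrightarrow> r - s < \<delta> \<Longrightarrow> variation u s r \<le> ennreal 1"
    using absolutely_continuous_on_variation_small[OF assms(1) zero_less_one] by metis
  \<comment> \<open>\<open>min b\<close> caps the walk at \<open>b\<close>, so the induction needs
    no bound on \<open>n\<close>; halving \<delta> keeps each step strictly shorter than
    \<delta>.\<close>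
  have fin: "variation u a (min b (a + real n * (\<delta> / 2))) < top" for n :: nat
  proof (induction n)
    case 0
    then show ?case
      using assms(2) by (simp add: variation_self)
  next
    case (Suc n)
    let ?x = "min b (a + real n * (\<delta> / 2))" and ?y = "min b (a + real (Suc n) * (\<delta> / 2))"
    have "a \<le> ?x" "?x \<le> ?y" "?y \<le> b" "?y - ?x < \<delta>"
      using assms(2) \<open>\<delta> > 0\<close> by (auto simp: min_def field_simps)
    then have "variation u a ?y \<le> variation u a ?x + ennreal 1"
      using variation_subadditive[of a ?x ?y u] \<delta>[of ?x ?y] by (meson add_left_mono order_trans)
    then show ?case
      using Suc.IH by (metis ennreal_add_less_top ennreal_less_top order_le_less_trans)
  qed
  obtain n :: nat where "(b - a) / (\<delta> / 2) < real n"
    using reals_Archimedean2 by blast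
  then have "min b (a + real n * (\<delta> / 2)) = b"
    using \<open>\<delta> > 0\<close> by (simp add: field_simps min_def)
  with fin[of n] show ?thesis by simp
qed

text \<open>Finiteness makes the passage to the reals monotone, since \<open>enn2real\<close> sends
  infinity to 0.\<close>

lemma real_variation_append:
  assumes "variation u a b < top" "a \<le> s" "s \<le> t" "t \<le> b"
  shows "enn2real (variation u a s) + norm (u t - u s) \<le> enn2real (variation u a t)"
proof -
  have "variation u a t < top"
    using variation_mono[of a t b u] assms by (simp add: order_le_less_trans)
  then have "enn2real (variation u a s + ennreal (norm (u t - u s))) \<le> enn2real (variation u a t)"
    using variation_append[of a s t u] assms by (intro enn2real_mono) auto
  moreover have "variation u a s < top"
    using variation_mono[of a s b u] assms by (simp add: order_le_less_trans)
  ultimately show ?thesis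
    by (simp add: enn2real_plus)
qed

text \<open>Reduces the approximation of the vector-valued \<open>u\<close> to that of its scalar
  variation function.\<close>

lemma norm_diff_le_real_variation:
  assumes "variation u a b < top" "s \<in> {a..b}" "t \<in> {a..b}"
  shows "norm (u t - u s) \<le> \<bar>enn2real (variation u a t) - enn2real (variation u a s)\<bar>"
  using real_variation_append[OF assms(1), of s t] real_variation_append[OF assms(1), of t s] assms(2,3)
  by (cases "s \<le> t") (auto simp: norm_minus_commute)

lemma real_variation_mono:
  assumes "variation u a b < top" "a \<le> s" "s \<le> t" "t \<le> b"
  shows "enn2real (variation u a s) \<le> enn2real (variation u a t)"
  using real_variation_append[OF assms] norm_ge_zero[of "u t - u s"] by linarith

text \<open>By subadditivity the increment of the variation function over \<open>[s,r]\<close> is at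
  most the variation on \<open>[s,r]\<close>, which is small on short intervals.\<close>

lemma continuous_on_real_variation:
  assumes "absolutely_continuous_on a b u" "a \<le> b"
  shows "continuous_on {a..b} (\<lambda>t. enn2real (variation u a t))" (is "continuous_on _ ?\<alpha>")
  unfolding continuous_on_iff
proof (intro ballI allI impI)
  fix x \<epsilon> :: real
  assume x: "x \<in> {a..b}" and "\<epsilon> > 0"
  note fin = absolutely_continuous_on_variation_finite[OF assms]
  \<comment> \<open>Half of \<epsilon>, because the bound on the variation is weak while continuity
    asks for a strict one.\<close>
  obtain \<delta> where "\<delta> > 0" and \<delta>:
    "\<And>s r. a \<le> s \<Longrightarrow> s \<le> r \<Longrightarrow> r \<le> b \<Longrightarrow> r - s < \<delta> \<Longrightarrow> variation u s r \<le> ennreal (\<epsilon> / 2)"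
    using absolutely_continuous_on_variation_small[OF assms(1), of "\<epsilon> / 2"] \<open>\<epsilon> > 0\<close> by auto
  have near: "\<bar>?\<alpha> r - ?\<alpha> s\<bar> < \<epsilon>" if "a \<le> s" "s \<le> r" "r \<le> b" "r - s < \<delta>" for s r
  proof -
    have "variation u a s < top"
      using variation_mono[of a s b u] fin that by (simp add: order_le_less_trans)
    moreover have "variation u a r \<le> variation u a s + ennreal (\<epsilon> / 2)"
      using variation_subadditive[OF that(1,2), of u] \<delta>[OF that]
      by (meson add_left_mono order_trans)
    ultimately have "?\<alpha> r \<le> enn2real (variation u a s + ennreal (\<epsilon> / 2))"
      by (intro enn2real_mono) auto
    also have "\<dots> = ?\<alpha> s + \<epsilon> / 2"
      using \<open>variation u a s < top\<close> \<open>\<epsilon> > 0\<close> by (simp add: enn2real_plus)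
    finally show ?thesis
      using real_variation_mono[OF fin that(1-3)] \<open>\<epsilon> > 0\<close> by linarith
  qed
  show "\<exists>d>0. \<forall>x'\<in>{a..b}. dist x' x < d \<longrightarrow> dist (?\<alpha> x') (?\<alpha> x) < \<epsilon>"
  proof (intro exI[of _ \<delta>] conjI ballI impI)
    fix y
    assume "y \<in> {a..b}" "dist y x < \<delta>"
    then show "dist (?\<alpha> y) (?\<alpha> x) < \<epsilon>"
      using near[of x y] near[of y x] x
      by (cases "x \<le> y") (auto simp: dist_real_def abs_minus_commute)
  qed (fact \<open>\<delta> > 0\<close>)
qed

lemma absolutely_continuous_on_imp_continuous_on:
  assumes "absolutely_continuous_on a b u" "a \<le> b"
  shows "continuous_on {a..b} u"
  unfolding continuous_on_iff
proof (intro ballI allI impI)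
  fix x \<epsilon> :: real
  assume x: "x \<in> {a..b}" and "\<epsilon> > 0"
  then obtain d where "d > 0" and d: "\<And>y. y \<in> {a..b} \<Longrightarrow> dist y x < d \<Longrightarrow>
      dist (enn2real (variation u a y)) (enn2real (variation u a x)) < \<epsilon>"
    using continuous_on_real_variation[OF assms] unfolding continuous_on_iff by metis
  have "dist (u y) (u x) < \<epsilon>" if "y \<in> {a..b}" "dist y x < d" for y
    using norm_diff_le_real_variation[OF absolutely_continuous_on_variation_finite[OF assms] x that(1)]
      d[OF that] by (simp add: dist_norm)
  with \<open>d > 0\<close> show "\<exists>d>0. \<forall>y\<in>{a..b}. dist y x < d \<longrightarrow> dist (u y) (u x) < \<epsilon>"
    by blast
qed

section \<open>Attained levels, measurability and essential suprema\<close>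

lemma least_level_point:
  fixes g :: "real \<Rightarrow> real"
  assumes "continuous_on {a..b} g" "g a \<le> c" "c \<le> g b" "a \<le> b"
  obtains x where "x \<in> {a..b}" "g x = c" "\<And>y. y \<in> {a..b} \<Longrightarrow> g y = c \<Longrightarrow> x \<le> y"
proof -
  \<comment> \<open>The level set is nonempty by the intermediate value theorem and compact by
    continuity, so it has a minimum. This gives the \<open>LEAST\<close> in
    \<open>equal_variation_time\<close> its intended meaning.\<close>
  let ?S = "{x \<in> {a..b}. g x = c}"
  have "closed ?S"
    by (intro continuous_closed_preimage_constant assms) simp
  then have "compact ({a..b} \<inter> ?S)"
    by (intro compact_Int_closed) auto
  moreover have "{a..b} \<inter> ?S \<noteq> {}"
    using IVT'[OF assms(2,3,4,1)] by auto
  ultimately obtain x where "x \<in> {a..b} \<inter> ?S" "\<forall>y\<in>{a..b} \<inter> ?S. x \<le> y"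
    by (rule compact_attains_inf[THEN bexE])
  with that show thesis by blast
qed

lemma borel_measurable_step_function:
  fixes z :: "real \<Rightarrow> 'a::euclidean_space"
  assumes "z \<in> step_functions T N"
  shows "z \<in> borel_measurable (lebesgue_on {0..T})"
proof -
  obtain M t v where t: "t 0 = 0" "t M = T" "\<forall>k<M. t k < t (Suc k)"
    and z: "\<forall>k\<in>{1..M}. \<forall>s\<in>{t (k - 1)..<t k}. z s = v (k - 1)"
    using assms unfolding step_functions_def by blast
  \<comment> \<open>The half-open pieces miss \<open>T\<close>, hence the extra singleton;
    \<open>z\<close> is constant on every member of this finite cover.\<close>
  let ?C = "insert {T} ((\<lambda>k. {t (k - 1)..<t k}) ` {1..M})"
  show ?thesis
  proof (rule measurable_piecewise_restrict[where C = ?C])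
    show "space (lebesgue_on {0..T}) \<subseteq> \<Union>?C"
    proof
      fix s assume s: "s \<in> space (lebesgue_on {0..T})"
      show "s \<in> \<Union>?C"
      proof (cases "s = T")
        case False
        then obtain k where "k \<in> {1..M}" "t (k - 1) \<le> s" "s < t k"
          using chain_interval[OF t(3), of s] t s by auto
        then show ?thesis by fastforce
      qed simp
    qed
    fix \<Omega> assume \<Omega>: "\<Omega> \<in> ?C"
    then have "\<Omega> \<in> sets lebesgue" by auto
    then show "\<Omega> \<inter> space (lebesgue_on {0..T}) \<in> sets (lebesgue_on {0..T})"
      by (auto simp: sets_restrict_space)
    obtain c where "\<And>s. s \<in> \<Omega> \<Longrightarrow> z s = c"
      using \<Omega> z by blast
    then show "z \<in> restrict_space (lebesgue_on {0..T}) \<Omega> \<rightarrow>\<^sub>M borel"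
      by (subst measurable_cong[where g = "\<lambda>_. c"]) (auto simp: space_restrict_space)
  qed auto
qed

text \<open>Measurability matters here: \<open>esssup\<close> of a nonmeasurable function is the top
  element.\<close>

lemma Linf_norm_le:
  fixes u :: "real \<Rightarrow> 'a::euclidean_space"
  assumes "u \<in> borel_measurable (lebesgue_on {0..T})" "\<And>t. t \<in> {0..T} \<Longrightarrow> norm (u t) \<le> c"
  shows "Linf_norm T u \<le> ennreal c"
  unfolding Linf_norm_def using assms
  by (intro esssup_I) (auto intro!: AE_I2 ennreal_leI)

subsection \<open>The sampled equal-variation encoder\<close>

context
  fixes T :: real and N :: nat and u :: "real \<Rightarrow> 'a::euclidean_space"
  assumes T: "T > 0" and N: "N \<ge> 1"
    and ac: "absolutely_continuous_on 0 T u" and nz: "variation u 0 T \<noteq> 0"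
begin

private abbreviation "\<alpha> t \<equiv> enn2real (variation u 0 t)"
private abbreviation "\<theta> \<equiv> equal_variation_time T N u"

private lemma fin: "variation u 0 T < top"
  using absolutely_continuous_on_variation_finite[OF ac] T by simp

private lemma total_pos: "\<alpha> T > 0"
  using fin nz by (simp add: enn2real_positive_iff zero_less_iff_neq_zero)

text \<open>Transfers the \<open>ennreal\<close> level equations to the reals, with
  \<open>n = N\<close> for the times and \<open>n = 2 * N\<close> for the sampling points.\<close>

lemma variation_eq_fraction_iff:
  assumes "t \<in> {0..T}" "n > 0"
  shows "variation u 0 t = of_nat k * variation u 0 T / of_nat n \<longleftrightarrow> \<alpha> t = real k * \<alpha> T / real n"
proof -
  have "variation u 0 t < top"
    using variation_mono[of 0 t T u] fin assms by (simp add: order_le_less_trans)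
  then have t: "variation u 0 t = ennreal (\<alpha> t)" by simp
  have "of_nat k * variation u 0 T / of_nat n = ennreal (real k) * ennreal (\<alpha> T) / ennreal (real n)"
    using fin by (simp add: ennreal_of_nat_eq_real_of_nat)
  also have "\<dots> = ennreal (real k * \<alpha> T / real n)"
    using assms by (simp add: divide_ennreal flip: ennreal_mult)
  finally show ?thesis
    by (subst t) simp
qed

lemma level_attained:
  assumes "0 \<le> c" "c \<le> \<alpha> T"
  obtains t where "t \<in> {0..T}" "\<alpha> t = c" "\<And>s. s \<in> {0..T} \<Longrightarrow> \<alpha> s = c \<Longrightarrow> t \<le> s"
  using least_level_point[OF continuous_on_real_variation[OF ac], of c] assms T
  by (auto simp: variation_self)

lemma fraction_bounds:
  assumes "k \<le> n" "n > 0"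
  shows "0 \<le> real k * \<alpha> T / real n" "real k * \<alpha> T / real n \<le> \<alpha> T"
  using total_pos assms by (auto simp: field_simps)

text \<open>For \<open>k < N\<close> the \<open>LEAST\<close> is attained by
  \<open>level_attained\<close>; for \<open>k = N\<close> the definition returns \<open>T\<close>,
  whose level is the whole variation.\<close>

lemma equal_variation_time:
  assumes "k \<le> N"
  shows "\<theta> k \<in> {0..T} \<and> \<alpha> (\<theta> k) = real k * \<alpha> T / real N"
proof (cases "k = N")
  case False
  obtain t where t: "t \<in> {0..T}" "\<alpha> t = real k * \<alpha> T / real N"
    "\<And>s. s \<in> {0..T} \<Longrightarrow> \<alpha> s = real k * \<alpha> T / real N \<Longrightarrow> t \<le> s"
    using level_attained[OF fraction_bounds[OF assms]] N by auto
  have "\<theta> k = t"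
    unfolding equal_variation_time_def using t False N
    by (auto intro!: Least_equality simp: variation_eq_fraction_iff)
  with t show ?thesis by simp
qed (use T N in \<open>simp add: equal_variation_time_def\<close>)

text \<open>The levels of the two times increase strictly because the total variation is positive,
  and a monotone \<alpha> then forces the times into the same order.\<close>

lemma equal_variation_time_less:
  assumes "k < N"
  shows "\<theta> k < \<theta> (Suc k)"
proof (rule ccontr)
  assume "\<not> ?thesis"
  then have "\<alpha> (\<theta> (Suc k)) \<le> \<alpha> (\<theta> k)"
    using equal_variation_time[of k] equal_variation_time[of "Suc k"] assms
    by (intro real_variation_mono[OF fin]) auto
  moreover have "real k * \<alpha> T / real N < real (Suc k) * \<alpha> T / real N"
    using total_pos N by (intro divide_strict_right_mono mult_strict_right_mono) auto
  ultimately show False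
    using equal_variation_time[of k] equal_variation_time[of "Suc k"] assms by simp
qed

lemma equal_variation_time_0: "\<theta> 0 = 0"
  unfolding equal_variation_time_def using N T
  by (auto intro!: Least_equality simp: variation_self)

lemma equal_variation_time_N: "\<theta> N = T"
  by (simp add: equal_variation_time_def)

text \<open>The required level is the midpoint of the levels at the two ends of the piece, so the
  intermediate value theorem applies.\<close>

lemma sample_point_exists:
  assumes "k \<in> {1..N}"
  obtains s where "s \<in> {\<theta> (k - 1)..\<theta> k}"
    "variation u 0 s = of_nat (2 * k - 1) * variation u 0 T / of_nat (2 * N)"
proof -
  have lo: "\<theta> (k - 1) \<in> {0..T}" "\<alpha> (\<theta> (k - 1)) = real (k - 1) * \<alpha> T / real N"
    and hi: "\<theta> k \<in> {0..T}" "\<alpha> (\<theta> k) = real k * \<alpha> T / real N"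
    using equal_variation_time[of "k - 1"] equal_variation_time[of k] assms by auto
  have "continuous_on {\<theta> (k - 1)..\<theta> k} \<alpha>"
    using continuous_on_real_variation[OF ac] T lo hi
    by (auto intro: continuous_on_subset)
  moreover have "\<theta> (k - 1) \<le> \<theta> k"
    using equal_variation_time_less[of "k - 1"] assms by (cases k) auto
  moreover have "\<alpha> (\<theta> (k - 1)) \<le> real (2 * k - 1) * \<alpha> T / real (2 * N)"
    "real (2 * k - 1) * \<alpha> T / real (2 * N) \<le> \<alpha> (\<theta> k)"
    unfolding lo hi using assms N total_pos by (simp_all add: field_simps of_nat_diff)
  ultimately obtain s where "\<theta> (k - 1) \<le> s" "s \<le> \<theta> k" "\<alpha> s = real (2 * k - 1) * \<alpha> T / real (2 * N)"
    using IVT'[of \<alpha> "\<theta> (k - 1)" _ "\<theta> k"] by blast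
  then show thesis
    using lo hi N variation_eq_fraction_iff[of s "2 * N" "2 * k - 1"] by (intro that[of s]) auto
qed

lemma sampled_output_exists_pos: "\<exists>z. sampled_equal_variation_output T N u z"
proof -
  have "\<forall>k\<in>{1..N}. \<exists>s. s \<in> {\<theta> (k - 1)..\<theta> k} \<and>
    variation u 0 s = of_nat (2 * k - 1) * variation u 0 T / of_nat (2 * N)"
    using sample_point_exists by blast
  then obtain \<tau> where \<tau>: "\<forall>k\<in>{1..N}. \<tau> k \<in> {\<theta> (k - 1)..\<theta> k} \<and>
    variation u 0 (\<tau> k) = of_nat (2 * k - 1) * variation u 0 T / of_nat (2 * N)"
    by metis
  \<comment> \<open>\<open>LEAST k. t < \<theta> k\<close> is the index of the piece containing
    \<open>t\<close>. The value at \<open>T\<close> is set apart, as no piece contains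
    \<open>T\<close>.\<close>
  define z where "z = (\<lambda>t\<in>{0..T}. if t = T then u T else u (\<tau> (LEAST k. t < \<theta> k)))"
  have dec: "\<forall>k<N. \<theta> k < \<theta> (Suc k)"
    using equal_variation_time_less by blast
  have "z t = u (\<tau> k)" if k: "k \<in> {1..N}" and t: "t \<in> {\<theta> (k - 1)..<\<theta> k}" for k t
  proof -
    have "(LEAST k. t < \<theta> k) = k"
    proof (rule Least_equality)
      fix j assume "t < \<theta> j"
      then show "k \<le> j"
        \<comment> \<open>An index \<open>j < k\<close> would give
          \<open>\<theta> j \<le> \<theta> (k - 1) \<le> t\<close>.\<close>
        using chain_mono[OF dec, of j "k - 1"] t k by (cases "k \<le> j") fastforce+
    qed (use t in auto)
    moreover have "0 \<le> t" "t < T"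
      using chain_mono[OF dec, of 0 "k - 1"] chain_mono[OF dec, of k N] k t
      by (cases k; simp add: equal_variation_time_0 equal_variation_time_N)+
    ultimately show ?thesis
      by (simp add: z_def)
  qed
  moreover have "z \<in> extensional {0..T}" "z T = u T"
    using T by (auto simp: z_def)
  ultimately show ?thesis
    unfolding sampled_equal_variation_output_def if_not_P[OF nz] using \<tau>
    by (intro exI[of _ z] conjI exI[of _ \<tau>]) auto
qed

lemma sampled_output_step_pos:
  assumes "sampled_equal_variation_output T N u z"
  shows "z \<in> step_functions T N"
proof -
  obtain \<tau> where z: "z \<in> extensional {0..T}" "z T = u T"
    "\<forall>k\<in>{1..N}. \<forall>t\<in>{\<theta> (k - 1)..<\<theta> k}. z t = u (\<tau> k)"
    using assms nz unfolding sampled_equal_variation_output_def by auto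
  \<comment> \<open>\<open>step_functions\<close> numbers values from 0 while the \<tau> start at 1,
    hence the shift; index \<open>N\<close> carries the value at \<open>T\<close>.\<close>
  define v where "v k = (if k = N then u T else u (\<tau> (Suc k)))" for k
  have "\<forall>k\<in>{1..N}. \<forall>t\<in>{\<theta> (k - 1)..<\<theta> k}. z t = v (k - 1)"
    using z(3) by (auto simp: v_def)
  moreover have "z T = v N"
    using z by (simp add: v_def)
  moreover have "\<forall>k<N. \<theta> k < \<theta> (Suc k)"
    using equal_variation_time_less by blast
  ultimately show ?thesis
    unfolding step_functions_def using z(1) equal_variation_time_0 equal_variation_time_N
    by blast
qed

lemma sampled_output_error_pos:
  assumes "sampled_equal_variation_output T N u z" "t \<in> {0..T}"
  shows "norm (u t - z t) \<le> \<alpha> T / (2 * real N)"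
proof (cases "t = T")
  case True
  then show ?thesis
    using assms nz total_pos by (simp add: sampled_equal_variation_output_def)
next
  case False
  have "\<forall>k<N. \<theta> k < \<theta> (Suc k)"
    using equal_variation_time_less by blast
  then obtain k where k: "k \<in> {1..N}" "\<theta> (k - 1) \<le> t" "t < \<theta> k"
    using chain_interval[of N \<theta> t] assms(2) False
    by (auto simp: equal_variation_time_0 equal_variation_time_N)
  obtain s where s: "s \<in> {\<theta> (k - 1)..\<theta> k}" "z t = u s"
    "variation u 0 s = of_nat (2 * k - 1) * variation u 0 T / of_nat (2 * N)"
    using assms(1)[unfolded sampled_equal_variation_output_def if_not_P[OF nz]] k atLeastLessThan_iff
    by blast
  have lo: "\<theta> (k - 1) \<in> {0..T}" "\<alpha> (\<theta> (k - 1)) = real (k - 1) * \<alpha> T / real N"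
    and hi: "\<theta> k \<in> {0..T}" "\<alpha> (\<theta> k) = real k * \<alpha> T / real N"
    using equal_variation_time[of "k - 1"] equal_variation_time[of k] k by auto
  have "s \<in> {0..T}"
    using s lo hi by auto
  then have \<alpha>s: "\<alpha> s = real (2 * k - 1) * \<alpha> T / real (2 * N)"
    using s(3) N variation_eq_fraction_iff[of s "2 * N" "2 * k - 1"] by simp
  have "\<alpha> (\<theta> (k - 1)) \<le> \<alpha> t" "\<alpha> t \<le> \<alpha> (\<theta> k)"
    using k lo(1) hi(1) assms(2) by (simp_all add: real_variation_mono[OF fin])
  \<comment> \<open>The level of \<open>s\<close> lies exactly \<open>\<alpha> T / (2 * N)\<close>
    from the levels at both ends of the piece.\<close>
  then have "\<bar>\<alpha> t - \<alpha> s\<bar> \<le> \<alpha> T / (2 * real N)"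
    unfolding lo hi \<alpha>s using k N by (simp add: abs_le_iff field_simps of_nat_diff)
  then show ?thesis
    using norm_diff_le_real_variation[OF fin \<open>s \<in> {0..T}\<close> assms(2)] s(2) by simp
qed

end

section \<open>The encoder on inputs of arbitrary variation, including zero\<close>

lemma sampled_equal_variation_output_exists:
  fixes u :: "real \<Rightarrow> 'a::euclidean_space"
  assumes "T > 0" "N \<ge> 1" "absolutely_continuous_on 0 T u"
  shows "\<exists>z. sampled_equal_variation_output T N u z"
  using sampled_output_exists_pos[OF assms]
  by (cases "variation u 0 T = 0") (auto simp: sampled_equal_variation_output_def)

lemma sampled_equal_variation_output_step_function:
  fixes u :: "real \<Rightarrow> 'a::euclidean_space"
  assumes "T > 0" "N \<ge> 1" "absolutely_continuous_on 0 T u"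
    "sampled_equal_variation_output T N u z"
  shows "z \<in> step_functions T N"
proof (cases "variation u 0 T = 0")
  case True
  then have z: "z = (\<lambda>t\<in>{0..T}. u 0)"
    using assms(4) by (simp add: sampled_equal_variation_output_def)
  show ?thesis
    unfolding step_functions_def z using assms(1,2)
    \<comment> \<open>A constant output is a step function with the single piece
      \<open>[0,T)\<close>, admissible because \<open>N \<ge> 1\<close>.\<close>
    by (auto intro!: exI[of _ 1] exI[of _ "\<lambda>k. if k = 0 then 0 else T"] exI[of _ "\<lambda>_. u 0"])
qed (use assms sampled_output_step_pos in blast)

lemma norm_sampled_equal_variation_output_le:
  fixes u :: "real \<Rightarrow> 'a::euclidean_space"
  assumes "T > 0" "N \<ge> 1" "absolutely_continuous_on 0 T u"
    "sampled_equal_variation_output T N u z" "t \<in> {0..T}"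
  shows "norm (u t - z t) \<le> enn2real (variation u 0 T) / (2 * real N)"
proof (cases "variation u 0 T = 0")
  case True
  then have "z t = u 0"
    using assms(4,5) by (simp add: sampled_equal_variation_output_def)
  \<comment> \<open>Zero variation makes \<open>u\<close> constant on \<open>[0,T]\<close>, so the
    output is exact.\<close>
  moreover have "variation u 0 t = 0"
    using variation_mono[of 0 t T u] assms(5) True by simp
  then have "norm (u t - u 0) = 0"
    using norm_diff_le_variation[of 0 t u] assms(5) by (simp add: ennreal_eq_0_iff)
  ultimately show ?thesis
    using True by simp
qed (use assms sampled_output_error_pos in blast)

lemma Linf_norm_sampled_equal_variation_output_le:
  fixes u :: "real \<Rightarrow> 'a::euclidean_space"
  assumes "T > 0" "N \<ge> 1" and ac: "absolutely_continuous_on 0 T u"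
    and z: "sampled_equal_variation_output T N u z"
  shows "Linf_norm T (\<lambda>t. u t - z t) \<le> ennreal (1 / (2 * real N)) * BV0_norm T u"
proof -
  have "u \<in> borel_measurable (lebesgue_on {0..T})"
    using absolutely_continuous_on_imp_continuous_on[OF ac] assms(1)
    by (intro continuous_imp_measurable_on_sets_lebesgue) auto
  moreover have "z \<in> borel_measurable (lebesgue_on {0..T})"
    using borel_measurable_step_function sampled_equal_variation_output_step_function[OF assms] .
  ultimately have "Linf_norm T (\<lambda>t. u t - z t) \<le> ennreal (enn2real (variation u 0 T) / (2 * real N))"
    using norm_sampled_equal_variation_output_le[OF assms]
    by (intro Linf_norm_le borel_measurable_diff)
  also have "\<dots> = ennreal (1 / (2 * real N) * enn2real (variation u 0 T))"
    by simp
  also have "\<dots> = ennreal (1 / (2 * real N)) * variation u 0 T"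
    using absolutely_continuous_on_variation_finite[OF ac] assms(1) by (subst ennreal_mult) auto
  also have "\<dots> \<le> ennreal (1 / (2 * real N)) * BV0_norm T u"
    unfolding BV0_norm_def by (intro mult_left_mono) auto
  finally show ?thesis .
qed

subsection \<open>The ramp and the lower bound\<close>

text \<open>The extremal input for the lower bound. It starts at 0, so its BV norm is its variation
  alone; the restriction to \<open>[0,T]\<close> makes it extensional, as \<open>W11\<close>
  demands.\<close>

definition ramp :: "real \<Rightarrow> 'a \<Rightarrow> real \<Rightarrow> 'a::euclidean_space" where
  "ramp T e = (\<lambda>t\<in>{0..T}. (t / T) *\<^sub>R e)"

lemma norm_ramp_diff:
  assumes "T > 0" "norm e = 1" "s \<in> {0..T}" "t \<in> {0..T}"
  shows "norm (ramp T e t - ramp T e s) = \<bar>t - s\<bar> / T"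
  using assms by (simp add: ramp_def flip: scaleR_left_diff_distrib diff_divide_distrib)

lemma absolutely_continuous_ramp:
  assumes "T > 0" "norm e = 1"
  shows "absolutely_continuous_on 0 T (ramp T e)"
  unfolding absolutely_continuous_on_def
proof (intro allI impI)
  fix \<epsilon> :: real
  assume "\<epsilon> > 0"
  show "\<exists>\<delta>>0. \<forall>(m::nat) l r.
       (\<forall>i<m. 0 \<le> l i \<and> l i \<le> r i \<and> r i \<le> T) \<and>
       disjoint_family_on (\<lambda>i. {l i<..<r i}) {..<m} \<and>
       (\<Sum>i<m. r i - l i) < \<delta> \<longrightarrow>
       (\<Sum>i<m. norm (ramp T e (r i) - ramp T e (l i))) < \<epsilon>"
  \<comment> \<open>The ramp is Lipschitz with constant \<open>1 / T\<close>.\<close>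
  proof (intro exI[of _ "\<epsilon> * T"] conjI allI impI; (elim conjE)?)
    fix m :: nat and l r :: "nat \<Rightarrow> real"
    assume lr: "\<forall>i<m. 0 \<le> l i \<and> l i \<le> r i \<and> r i \<le> T" and "(\<Sum>i<m. r i - l i) < \<epsilon> * T"
    have "(\<Sum>i<m. norm (ramp T e (r i) - ramp T e (l i))) = (\<Sum>i<m. (r i - l i) / T)"
      using lr by (intro sum.cong refl, subst norm_ramp_diff[OF assms]) force+
    also have "\<dots> = (\<Sum>i<m. r i - l i) / T"
      by (simp add: sum_divide_distrib)
    also have "\<dots> < \<epsilon>"
      using \<open>(\<Sum>i<m. r i - l i) < \<epsilon> * T\<close> assms by (simp add: pos_divide_less_eq)
    finally show "(\<Sum>i<m. norm (ramp T e (r i) - ramp T e (l i))) < \<epsilon>" .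
  qed (use \<open>\<epsilon> > 0\<close> assms in auto)
qed

text \<open>The increments along any partition telescope to 1. An upper bound is the useful
  direction: a smaller denominator only raises the normalised error.\<close>

lemma BV0_norm_ramp_le:
  assumes "T > 0" "norm e = 1"
  shows "BV0_norm T (ramp T e) \<le> 1"
proof -
  have "variation (ramp T e) 0 T \<le> 1"
  proof (rule variation_le)
    fix m and t :: "nat \<Rightarrow> real"
    assume t: "t 0 = 0" "t m = T" "\<forall>j<m. t j < t (Suc j)"
    have dom: "t j \<in> {0..T}" if "j \<le> m" for j
      using chain_mono[OF t(3), of 0 j] chain_mono[OF t(3), of j m] t that by simp
    have "norm (ramp T e (t (Suc j)) - ramp T e (t j)) = (t (Suc j) - t j) / T" if "j < m" for j
      using norm_ramp_diff[OF assms dom dom, of j "Suc j"] t(3) that by (simp add: less_imp_le)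
    then have "(\<Sum>j<m. norm (ramp T e (t (Suc j)) - ramp T e (t j))) = (\<Sum>j<m. t (Suc j) - t j) / T"
      by (simp add: sum_divide_distrib)
    also have "\<dots> = 1"
      using t assms by (simp add: sum_lessThan_telescope)
    finally show "(\<Sum>j<m. ennreal (norm (ramp T e (t (Suc j)) - ramp T e (t j)))) \<le> 1"
      by (simp add: sum_ennreal)
  qed
  then show ?thesis
    using assms by (simp add: BV0_norm_def ramp_def)
qed

text \<open>Integration by parts: the fundamental theorem of calculus applied to
  \<open>\<phi> x * x\<close>, whose boundary values vanish.\<close>

lemma weak_derivative_ramp:
  assumes "T > 0"
  shows "weak_derivative T (ramp T e) (\<lambda>_. (1 / T) *\<^sub>R e)"
  unfolding weak_derivative_def
proof (intro allI impI)
  fix \<phi> :: "real \<Rightarrow> real"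
  assume \<phi>: "test_function T \<phi>"
  then have diff: "(deriv ^^ k) \<phi> field_differentiable (at x)" for k x
    by (simp add: test_function_def)
  have D: "(\<phi> has_field_derivative deriv \<phi> x) (at x)" for x
    using diff[of 0] by (simp add: DERIV_deriv_iff_field_differentiable)
  have cont: "continuous_on {0..T} \<phi>" "continuous_on {0..T} (deriv \<phi>)"
    using diff[of 0] diff[of 1]
    by (auto intro!: continuous_at_imp_continuous_on field_differentiable_imp_continuous_at)
  \<comment> \<open>The support lies in the open interval, so \<phi> vanishes at both ends.\<close>
  have "0 \<notin> {x. \<phi> x \<noteq> 0}" "T \<notin> {x. \<phi> x \<noteq> 0}"
    using \<phi> closure_subset[of "{x. \<phi> x \<noteq> 0}"] unfolding test_function_def by force+
  then have bd: "\<phi> 0 = 0" "\<phi> T = 0" by auto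
  have "((\<lambda>x. deriv \<phi> x * x + \<phi> x) has_integral \<phi> T * T - \<phi> 0 * 0) {0..T}"
    using assms D
    by (intro fundamental_theorem_of_calculus)
      (auto intro!: derivative_eq_intros DERIV_subset[OF D] simp flip: has_real_derivative_iff_has_vector_derivative)
  then have "integral {0..T} (\<lambda>x. deriv \<phi> x * x + \<phi> x) = 0"
    using bd by (simp add: integral_unique)
  moreover have int: "(\<lambda>x. deriv \<phi> x * x) integrable_on {0..T}" "\<phi> integrable_on {0..T}"
    using cont by (auto intro!: integrable_continuous_interval continuous_intros)
  ultimately have parts: "integral {0..T} (\<lambda>x. deriv \<phi> x * x) = - integral {0..T} \<phi>"
    by (simp add: integral_add)
  have "integral {0..T} (\<lambda>t. deriv \<phi> t *\<^sub>R ramp T e t)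
      = integral {0..T} (\<lambda>t. (deriv \<phi> t * t) *\<^sub>R ((1 / T) *\<^sub>R e))"
    by (intro integral_cong) (simp add: ramp_def)
  also have "\<dots> = integral {0..T} (\<lambda>t. deriv \<phi> t * t) *\<^sub>R ((1 / T) *\<^sub>R e)"
    using int by (intro integral_unique has_integral_scaleR_left integrable_integral)
  also have "\<dots> = - (integral {0..T} \<phi> *\<^sub>R ((1 / T) *\<^sub>R e))"
    by (simp add: parts)
  also have "integral {0..T} \<phi> *\<^sub>R ((1 / T) *\<^sub>R e) = integral {0..T} (\<lambda>t. \<phi> t *\<^sub>R ((1 / T) *\<^sub>R e))"
    using int by (intro integral_unique[symmetric] has_integral_scaleR_left integrable_integral)
  finally show "integral {0..T} (\<lambda>t. deriv \<phi> t *\<^sub>R ramp T e t)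
      = - integral {0..T} (\<lambda>t. \<phi> t *\<^sub>R ((1 / T) *\<^sub>R e))" .
qed

lemma ramp_in_W11:
  assumes "T > 0" "norm e = 1"
  shows "ramp T e \<in> W11 T"
proof -
  note ac = absolutely_continuous_ramp[OF assms]
  have "ramp T e absolutely_integrable_on {0..T}"
    using absolutely_continuous_on_imp_continuous_on[OF ac] assms
    by (intro absolutely_integrable_continuous_real) auto
  moreover have "(\<lambda>_. (1 / T) *\<^sub>R e) absolutely_integrable_on {0..T}"
    by (intro absolutely_integrable_continuous_real continuous_intros)
  moreover have "ramp T e \<in> extensional {0..T}"
    by (simp add: ramp_def)
  ultimately show ?thesis
    unfolding W11_def using ac weak_derivative_ramp[OF assms(1), of e] by blast
qed

text \<open>A nonempty open interval has positive measure, so a property holding almost everywhere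
  cannot fail on all of it. This supplies points near the ends of a piece at which the essential
  bound holds.\<close>

lemma AE_lebesgue_on_ex:
  fixes a b :: real
  assumes "AE s in lebesgue_on {0..T}. P s" "0 \<le> a" "a < b" "b \<le> T"
  obtains s where "a < s" "s < b" "P s"
proof (rule ccontr)
  assume "\<not> thesis"
  then have "\<not> P s" if "s \<in> {a<..<b}" for s
    using \<open>\<And>s. a < s \<Longrightarrow> s < b \<Longrightarrow> P s \<Longrightarrow> thesis\<close> that by auto
  moreover have "AE s in lebesgue. s \<in> {0..T} \<longrightarrow> P s"
    using assms(1) by (simp add: AE_restrict_space_iff)
  ultimately have "AE s in lebesgue. s \<notin> {a<..<b}"
    using assms(2,4) by (auto elim!: eventually_mono)
  then have "emeasure lebesgue {a<..<b} = 0"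
    by (subst (asm) AE_iff_measurable[of "{a<..<b}"]) auto
  then show False
    using \<open>a < b\<close> by (simp add: emeasure_lborel_Ioo)
qed

lemma step_function_error_ramp:
  assumes "T > 0" "norm e = 1" "N \<ge> 1" "z \<in> step_functions T N"
  shows "ennreal (1 / (2 * real N)) \<le> Linf_norm T (\<lambda>t. ramp T e t - z t)"
proof (rule ccontr)
  assume "\<not> ?thesis"
  then have less: "Linf_norm T (\<lambda>t. ramp T e t - z t) < ennreal (1 / (2 * real N))"
    by simp
  then obtain c where c: "c \<ge> 0" "Linf_norm T (\<lambda>t. ramp T e t - z t) = ennreal c"
    by (cases "Linf_norm T (\<lambda>t. ramp T e t - z t)") auto
  then have cN: "c < 1 / (2 * real N)"
    using less by (simp add: ennreal_less_iff)
  have ae: "AE s in lebesgue_on {0..T}. norm (ramp T e s - z s) \<le> c"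
    using esssup_AE[of "\<lambda>t. ennreal (norm (ramp T e t - z t))" "lebesgue_on {0..T}"] c
    by (simp add: Linf_norm_def)
  obtain M t v where M: "M \<le> N" and t: "t 0 = 0" "t M = T" "\<forall>k<M. t k < t (Suc k)"
    and z: "\<forall>k\<in>{1..M}. \<forall>s\<in>{t (k - 1)..<t k}. z s = v (k - 1)"
    using assms(4) unfolding step_functions_def by blast
  \<comment> \<open>Pigeonhole: at most \<open>N\<close> pieces have total length
    \<open>T\<close>.\<close>
  have "\<exists>k<M. T / N \<le> t (Suc k) - t k"
  proof (rule ccontr)
    assume "\<not> ?thesis"
    then have short: "\<And>k. k < M \<Longrightarrow> t (Suc k) - t k < T / N"
      by force
    have "M > 0"
      using t assms(1) by (cases M) auto
    then have "(\<Sum>k<M. t (Suc k) - t k) < (\<Sum>k<M. T / N)"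
      using short by (intro sum_strict_mono) auto
    also have "\<dots> \<le> T"
      using M assms by (simp add: field_simps)
    finally show False
      using t by (simp add: sum_lessThan_telescope)
  qed
  then obtain k where k: "k < M" "T / N \<le> t (Suc k) - t k" by blast
  \<comment> \<open>A third of the excess of \<open>T / N\<close> over \<open>2 * c * T\<close>.
    Points within \<eta> of opposite ends of the long piece are more than
    \<open>T / N - 2 * \<eta> = 2 * c * T + \<eta>\<close> apart.\<close>
  define \<eta> where "\<eta> = (T / N - 2 * c * T) / 3"
  have \<eta>: "\<eta> > 0" "3 * \<eta> \<le> t (Suc k) - t k"
    using mult_strict_right_mono[OF cN assms(1)] mult_nonneg_nonneg[OF c(1), of T] assms(1) k(2)
    by (auto simp: \<eta>_def)
  have dom: "0 \<le> t k" "t (Suc k) \<le> T"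
    using chain_mono[OF t(3), of 0 k] chain_mono[OF t(3), of "Suc k" M] t k by auto
  obtain s where s: "t k < s" "s < t k + \<eta>" "norm (ramp T e s - z s) \<le> c"
    using AE_lebesgue_on_ex[OF ae, of "t k" "t k + \<eta>"] dom \<eta> by auto
  obtain r where r: "t (Suc k) - \<eta> < r" "r < t (Suc k)" "norm (ramp T e r - z r) \<le> c"
    using AE_lebesgue_on_ex[OF ae, of "t (Suc k) - \<eta>" "t (Suc k)"] dom \<eta> by auto
  \<comment> \<open>Both points lie in one piece, so a single value is within \<open>c\<close> of
    the ramp at both, and the ramp moves by at most \<open>2 * c\<close> between them.\<close>
  have "z s = z r"
    using z[rule_format, of "Suc k"] k s r \<eta> by simp
  then have "norm (ramp T e r - ramp T e s) \<le> 2 * c"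
    using norm_triangle_ineq4[of "ramp T e r - z r" "ramp T e s - z s"] s r by simp
  moreover have "norm (ramp T e r - ramp T e s) = (r - s) / T"
    using norm_ramp_diff[OF assms(1,2), of s r] s r dom \<eta> by simp
  ultimately have "r - s \<le> 2 * c * T"
    using assms(1) by (simp add: pos_divide_le_eq)
  moreover have "r - s > 2 * c * T"
    using s(2) r(1) k(2) \<eta>(1) unfolding \<eta>_def by argo
  ultimately show False by simp
qed

lemma input_error_ge:
  fixes f :: "(real \<Rightarrow> 'a::euclidean_space) \<Rightarrow> real \<Rightarrow> 'a"
  assumes "T > 0" "N \<ge> 1" "f \<in> encoders T N"
  shows "ennreal (1 / (2 * real N)) \<le> input_error T f"
proof -
  \<comment> \<open>A unit vector exists because the dimension is at least 1.\<close>
  obtain e :: 'a where "e \<in> Basis"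
    using nonempty_Basis by blast
  then have e: "norm e = 1" by simp
  let ?u = "ramp T e"
  have W: "?u \<in> W11 T"
    using ramp_in_W11 assms(1) e .
  have "?u T \<noteq> (\<lambda>t\<in>{0..T}. 0) T"
    using assms(1) e by (auto simp: ramp_def)
  then have "?u \<in> W11 T - {\<lambda>t\<in>{0..T}. 0}"
    using W by auto
  \<comment> \<open>Dividing by a norm of at most 1 cannot decrease the error.\<close>
  have BV: "1 \<le> inverse (BV0_norm T ?u)"
    using BV0_norm_ramp_le[OF assms(1) e]
    by (cases "BV0_norm T ?u"; cases "BV0_norm T ?u = 0") (auto simp: inverse_ennreal one_le_inverse_iff top_unique)
  have "ennreal (1 / (2 * real N)) \<le> Linf_norm T (\<lambda>t. ?u t - f ?u t) * 1"
    using step_function_error_ramp[OF assms(1) e assms(2), of "f ?u"] assms(3) W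
    by (auto simp: encoders_def)
  also have "\<dots> \<le> Linf_norm T (\<lambda>t. ?u t - f ?u t) / BV0_norm T ?u"
    unfolding divide_ennreal_def using BV by (rule mult_left_mono) simp
  also have "\<dots> \<le> input_error T f"
    unfolding input_error_def using \<open>?u \<in> W11 T - {\<lambda>t\<in>{0..T}. 0}\<close> by (intro SUP_upper2) auto
  finally show ?thesis .
qed

section \<open>Minimax value and its attainment\<close>

theorem theorem3p3:
  fixes T :: real and N :: nat
  assumes "T > 0" and "N \<ge> 1"
  shows "minimax_input_error TYPE('a::euclidean_space) T N = ennreal (1 / (2 * real N)) \<and>
    (\<exists>f :: (real \<Rightarrow> 'a) \<Rightarrow> (real \<Rightarrow> 'a). sampled_equal_variation_encoder T N f) \<and>
    (\<forall>f :: (real \<Rightarrow> 'a) \<Rightarrow> (real \<Rightarrow> 'a). sampled_equal_variation_encoder T N f \<longrightarrow>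
       f \<in> encoders T N \<and>
       input_error T f = ennreal (1 / (2 * real N)) \<and>
       (\<forall>\<pi>\<in>W11 T. Linf_norm T (\<lambda>t. \<pi> t - f \<pi> t) \<le> ennreal (1 / (2 * real N)) * BV0_norm T \<pi>))"
proof -
  let ?c = "ennreal (1 / (2 * real N))"
  have ac: "absolutely_continuous_on 0 T u" if "u \<in> W11 T" for u :: "real \<Rightarrow> 'a"
    using that by (simp add: W11_def)
  have main: "f \<in> encoders T N \<and> input_error T f = ?c \<and>
      (\<forall>\<pi>\<in>W11 T. Linf_norm T (\<lambda>t. \<pi> t - f \<pi> t) \<le> ?c * BV0_norm T \<pi>)"
    if "sampled_equal_variation_encoder T N f" for f :: "(real \<Rightarrow> 'a) \<Rightarrow> (real \<Rightarrow> 'a)"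
  proof (intro conjI)
    have out: "sampled_equal_variation_output T N \<pi> (f \<pi>)" if "\<pi> \<in> W11 T" for \<pi> :: "real \<Rightarrow> 'a"
      using \<open>sampled_equal_variation_encoder T N f\<close> that
      by (simp add: sampled_equal_variation_encoder_def)
    then show enc: "f \<in> encoders T N"
      using sampled_equal_variation_output_step_function[OF assms ac] by (auto simp: encoders_def)
    show bound: "\<forall>\<pi>\<in>W11 T. Linf_norm T (\<lambda>t. \<pi> t - f \<pi> t) \<le> ?c * BV0_norm T \<pi>"
      using Linf_norm_sampled_equal_variation_output_le[OF assms ac] out by blast
    have "input_error T f \<le> ?c"
      unfolding input_error_def
    proof (rule SUP_least)
      fix \<pi> :: "real \<Rightarrow> 'a"
      assume "\<pi> \<in> W11 T - {\<lambda>t\<in>{0..T}. 0}"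
      then have "Linf_norm T (\<lambda>t. \<pi> t - f \<pi> t) \<le> BV0_norm T \<pi> * ?c"
        using bound by (simp add: mult.commute)
      then show "Linf_norm T (\<lambda>t. \<pi> t - f \<pi> t) / BV0_norm T \<pi> \<le> ?c"
        \<comment> \<open>If the BV norm is 0, the bound forces the numerator to be 0, and
          \<open>0 / 0 = 0\<close> in \<open>ennreal\<close>.\<close>
        by (cases "BV0_norm T \<pi> = 0") (auto intro!: divide_le_posI_ennreal simp: zero_less_iff_neq_zero)
    qed
    then show "input_error T f = ?c"
      using input_error_ge[OF assms enc] by (rule antisym)
  qed
  have "\<forall>\<pi>\<in>W11 T. \<exists>z. sampled_equal_variation_output T N (\<pi> :: real \<Rightarrow> 'a) z"
    using sampled_equal_variation_output_exists[OF assms ac] by blast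
  \<comment> \<open>Choosing one output per input shows that the encoder predicate is satisfiable;
    \<open>g\<close> then witnesses the upper bound on the infimum.\<close>
  then obtain g :: "(real \<Rightarrow> 'a) \<Rightarrow> (real \<Rightarrow> 'a)" where g: "sampled_equal_variation_encoder T N g"
    unfolding sampled_equal_variation_encoder_def by metis
  have "minimax_input_error TYPE('a) T N = ?c"
    unfolding minimax_input_error_def
  proof (rule antisym)
    show "(INF f\<in>(encoders T N :: ((real \<Rightarrow> 'a) \<Rightarrow> (real \<Rightarrow> 'a)) set). input_error T f) \<le> ?c"
      using main[OF g] by (intro INF_lower2[of g]) auto
    show "?c \<le> (INF f\<in>(encoders T N :: ((real \<Rightarrow> 'a) \<Rightarrow> (real \<Rightarrow> 'a)) set). input_error T f)"
      using input_error_ge[OF assms] by (intro INF_greatest)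
  qed
  with g main show ?thesis by blast
qed

end
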